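(* Let $m\ge 2$ be even and $n\ge 1$, let $\mathcal{A}\in\mathbb{R}^{[n,m]}$ be a real symmetric tensor of order $m$ and dimension $n$, and put $d=n(m-1)^{n-1}$. Suppose that the $d$ eigenvalues of $\mathcal{A}$ (counted with multiplicity) are all real and positive, ordered as $\lambda_1\ge\lambda_2\ge\cdots\ge\lambda_d>0$. For every integer $k$ with $1\le k\le d-2$, $$\lambda_1\cdots\lambda_k\le\left\{\frac{1}{\det(\mathcal{A})}\left[\frac{1}{d-k}\left(\frac{(m-1)^{n-1}\operatorname{tr}(\mathcal{A})}{k+1}\right)^{k+1}\right]^{d-k}\right\}^{\frac{1}{d-k-1}}.$$ For every integer $k$ with $2\le k\le d-1$, $$\lambda_{d-k+1}\cdots\lambda_d\ge\left[k\,\det(\mathcal{A})\left(\frac{d-k+1}{(m-1)^{n-1}\operatorname{tr}(\mathcal{A})}\right)^{d-k+1}\right]^{k/(k-1)}.$$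
   Context: $\mathbb{R}^{[n,m]}$ is the set of real tensors $\mathcal{A}=(a_{i_1\cdots i_m})_{1\le i_1,\dots,i_m\le n}$ of order $m$ and dimension $n$. $\mathcal{A}$ is symmetric if its entries are invariant under every permutation of the indices. For a vector $x$, $\mathcal{A}x^{m-1}$ is the vector with $i$-th component $\sum_{i_2,\dots,i_m=1}^n a_{i i_2\cdots i_m}x_{i_2}\cdots x_{i_m}$. The identity tensor $\mathcal{I}$ has entry $1$ when $i_1=\cdots=i_m$ and $0$ otherwise. The trace $\operatorname{tr}(\mathcal{A})=\sum_{i=1}^n a_{ii\cdots i}$ is the sum of the diagonal entries. The resultant of $n$ homogeneous polynomials $f_1,\dots,f_n$ in $n$ variables of degrees $d_1,\dots,d_n$ is the unique polynomial in their coefficients such that (1) it vanishes if and only if $f_1=\cdots=f_n=0$ has a nonzero (complex) solution; (2) it equals $1$ when $f_i=x_i^{d_i}$ for all $i$; (3) it is irreducible when the coefficients are viewed as independent variables. The determinant $\det(\mathcal{A})$ is the resultant of the ordered system of $n$ homogeneous polynomials of degree $m-1$ given by the components of $\mathcal{A}x^{m-1}$. The eigenvalues of $\mathcal{A}$ are the complex roots of the characteristic polynomial $\phi(\lambda)=\det(\mathcal{A}-\lambda\mathcal{I})$, which has degree $d=n(m-1)^{n-1}$; counted with multiplicity there are $d$ of them. *)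

theory Defs
  imports
    "HOL-Analysis.Analysis"
    "HOL-Library.Poly_Mapping"
    "HOL-Combinatorics.Permutations"
    "HOL-Computational_Algebra.Computational_Algebra"
begin

section \<open>Integer polynomials in arbitrarily many variables\<close>

text \<open>
  A polynomial is a finitely supported map from power products to coefficients; ring operations
  (and hence \<^const>\<open>irreducible\<close>) on this type are those of the library theory Poly_Mapping.
\<close>

type_synonym 'v int_mpoly = "('v \<Rightarrow>\<^sub>0 nat) \<Rightarrow>\<^sub>0 int"

definition mpoly_vars :: "'v int_mpoly \<Rightarrow> 'v set" where
  "mpoly_vars p = (\<Union>t\<in>Poly_Mapping.keys p. Poly_Mapping.keys t)"

definition mpoly_eval :: "('v \<Rightarrow> 'a::comm_ring_1) \<Rightarrow> 'v int_mpoly \<Rightarrow> 'a" where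
  "mpoly_eval c p = (\<Sum>t\<in>Poly_Mapping.keys p. of_int (Poly_Mapping.lookup p t) *
    (\<Prod>v\<in>Poly_Mapping.keys t. c v ^ Poly_Mapping.lookup t v))"

section \<open>Resultants of square homogeneous systems\<close>

text \<open>
  The index type \<open>'n\<close> numbers both the unknowns and the equations. A monomial of degree \<open>e\<close> in
  the unknowns is the size-\<open>e\<close> multiset of its factors, e.g. \<open>{#i, i, j#}\<close> for the square of
  \<open>x\<^sub>i\<close> times \<open>x\<^sub>j\<close>; the pair \<open>(i, M)\<close> names the coefficient of the monomial \<open>M\<close> in the
  \<open>i\<close>-th equation.
\<close>

definition hom_eval :: "nat \<Rightarrow> ('n::finite multiset \<Rightarrow> 'a::comm_semiring_1) \<Rightarrow> 'a ^ 'n \<Rightarrow> 'a" where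
  "hom_eval e c x = (\<Sum>M | size M = e. c M * (\<Prod>j\<in>#M. x $ j))"

definition system_vars :: "('n::finite \<Rightarrow> nat) \<Rightarrow> ('n \<times> 'n multiset) set" where
  "system_vars e = {(i, M). size M = e i}"

definition power_system :: "('n::finite \<Rightarrow> nat) \<Rightarrow> 'n \<times> 'n multiset \<Rightarrow> int" where
  "power_system e = (\<lambda>(i, M). if M = replicate_mset (e i) i then 1 else 0)"

text \<open>
  The defining properties of the resultant of a system with degrees \<open>e\<close>. As usual the resultant
  has integer coefficients, so that it can be evaluated in every commutative ring. Up to the
  identification of \<open>R\<close> with a polynomial in the finitely many variables \<open>system_vars e\<close> (which
  does not affect irreducibility), exactly one \<open>R\<close> has these properties when all degrees are
  positive.
\<close>

definition is_resultant :: "('n::finite \<Rightarrow> nat) \<Rightarrow> ('n \<times> 'n multiset) int_mpoly \<Rightarrow> bool" where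
  "is_resultant e R \<longleftrightarrow>
     mpoly_vars R \<subseteq> system_vars e \<and>
     (\<forall>c :: 'n \<times> 'n multiset \<Rightarrow> complex.
        mpoly_eval c R = 0 \<longleftrightarrow> (\<exists>x. x \<noteq> 0 \<and> (\<forall>i. hom_eval (e i) (\<lambda>M. c (i, M)) x = 0))) \<and>
     mpoly_eval (power_system e) R = 1 \<and>
     irreducible R"

section \<open>Tensors\<close>

text \<open>
  A tensor of order \<open>m\<close> and dimension \<open>CARD('n)\<close> is a function on index lists, of which only the
  values on lists of length \<open>m\<close> matter.
\<close>

type_synonym ('a, 'n) tensor = "'n list \<Rightarrow> 'a"

definition symmetric_tensor :: "nat \<Rightarrow> ('a, 'n) tensor \<Rightarrow> bool" where
  "symmetric_tensor m A \<longleftrightarrow>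
     (\<forall>is \<sigma>. length is = m \<longrightarrow> \<sigma> permutes {..<m} \<longrightarrow> A (permute_list \<sigma> is) = A is)"

definition tensor_apply :: "nat \<Rightarrow> ('a::comm_semiring_1, 'n::finite) tensor \<Rightarrow> 'a ^ 'n \<Rightarrow> 'a ^ 'n" where
  "tensor_apply m A x =
     (\<chi> i. \<Sum>js | length js = m - 1. A (i # js) * (\<Prod>j\<leftarrow>js. x $ j))"

definition id_tensor :: "nat \<Rightarrow> ('a::zero_neq_one, 'n) tensor" where
  "id_tensor m = (\<lambda>is. if \<exists>i. is = replicate m i then 1 else 0)"

definition tensor_trace :: "nat \<Rightarrow> ('a::comm_monoid_add, 'n::finite) tensor \<Rightarrow> 'a" where
  "tensor_trace m A = (\<Sum>i\<in>UNIV. A (replicate m i))"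

text \<open>
  Coefficients of the components of \<open>tensor_apply m A x\<close> after collecting equal monomials, see
  the lemma below.
\<close>

definition tensor_system ::
    "nat \<Rightarrow> ('a::comm_monoid_add, 'n::finite) tensor \<Rightarrow> 'n \<times> 'n multiset \<Rightarrow> 'a" where
  "tensor_system m A = (\<lambda>(i, M). \<Sum>js | length js = m - 1 \<and> mset js = M. A (i # js))"

lemma hom_eval_tensor_system:
  fixes A :: "('a::comm_semiring_1, 'n::finite) tensor"
  shows "hom_eval (m - 1) (\<lambda>M. tensor_system m A (i, M)) x = tensor_apply m A x $ i"
proof -
  let ?S = "{js :: 'n list. length js = m - 1}" and ?T = "{M :: 'n multiset. size M = m - 1}"
  let ?g = "\<lambda>js. A (i # js) * (\<Prod>j\<leftarrow>js. x $ j)"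
  have fin: "finite ?S"
    using finite_lists_length_eq[of "UNIV :: 'n set" "m - 1"] by simp
  have T: "?T = mset ` ?S"
    by (auto simp: image_iff) (metis ex_mset size_mset)
  have "(\<Sum>js\<in>?S. ?g js) = (\<Sum>M\<in>mset ` ?S. \<Sum>js\<in>{js\<in>?S. mset js = M}. ?g js)"
    by (rule sum.image_gen[OF fin])
  also have "\<dots> = (\<Sum>M\<in>?T. tensor_system m A (i, M) * (\<Prod>j\<in>#M. x $ j))"
  proof (rule sum.cong)
    fix M :: "'n multiset"
    have "(\<Prod>j\<leftarrow>js. x $ j) = (\<Prod>j\<in>#M. x $ j)" if "mset js = M" for js
      using that by (metis mset_map prod_mset_prod_list)
    then show "(\<Sum>js\<in>{js\<in>?S. mset js = M}. ?g js) = tensor_system m A (i, M) * (\<Prod>j\<in>#M. x $ j)"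
      by (simp add: tensor_system_def sum_distrib_right)
  qed (rule T[symmetric])
  finally show ?thesis
    by (simp add: hom_eval_def tensor_apply_def)
qed

section \<open>Determinant and eigenvalues\<close>

text \<open>
  In the following, \<open>R\<close> stands for the resultant of \<open>CARD('n)\<close> forms of degree \<open>m - 1\<close>.
\<close>

definition tensor_det ::
    "('n \<times> 'n multiset) int_mpoly \<Rightarrow> nat \<Rightarrow> ('a::comm_ring_1, 'n::finite) tensor \<Rightarrow> 'a" where
  "tensor_det R m A = mpoly_eval (tensor_system m A) R"

text \<open>The determinant of \<open>A - \<lambda> I\<close>, formed over the polynomial ring in the variable \<open>\<lambda>\<close>.\<close>

definition tensor_charpoly ::
    "('n \<times> 'n multiset) int_mpoly \<Rightarrow> nat \<Rightarrow> ('a::comm_ring_1, 'n::finite) tensor \<Rightarrow> 'a poly" where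
  "tensor_charpoly R m A = tensor_det R m (\<lambda>is. [:A is:] - [:0, 1:] * id_tensor m is)"

lemma poly_tensor_charpoly:
  fixes A :: "('a::comm_ring_1, 'n::finite) tensor"
  shows "poly (tensor_charpoly R m A) z = tensor_det R m (\<lambda>is. A is - z * id_tensor m is)"
proof -
  have "poly (mpoly_eval c R) z = mpoly_eval (\<lambda>v. poly (c v) z) R"
    for c :: "'n \<times> 'n multiset \<Rightarrow> 'a poly"
    by (simp add: mpoly_eval_def poly_sum poly_prod poly_power of_int_poly)
  moreover have "(\<lambda>v. poly (tensor_system m (\<lambda>is. [:A is:] - [:0, 1:] * id_tensor m is) v) z) =
      tensor_system m (\<lambda>is. A is - z * id_tensor m is)"
    by (auto simp: tensor_system_def poly_sum id_tensor_def fun_eq_iff intro!: sum.cong)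
  ultimately show ?thesis
    by (simp add: tensor_charpoly_def tensor_det_def)
qed

definition eigenvalues ::
    "('n \<times> 'n multiset) int_mpoly \<Rightarrow> nat \<Rightarrow> (real, 'n::finite) tensor \<Rightarrow> complex multiset" where
  "eigenvalues R m A = proots (tensor_charpoly R m (\<lambda>is. complex_of_real (A is)))"

end

theory Submission
  imports Defs
begin

text \<open>
  The eigenvalues enter only through their sum \<open>(m - 1)\<^sup>n\<^sup>-\<^sup>1 tr A\<close> and their product \<open>det A\<close>.
  With \<open>p\<close> eigenvalues of product \<open>X\<close> and the remaining \<open>q\<close> of sum \<open>T\<close>, AM-GM bounds the
  product of the latter by \<open>(T/q)\<^sup>q\<close>, and AM-GM again, for the \<open>p + 1\<close> numbers consisting of
  the first group and \<open>T\<close>, bounds \<open>X T\<close>; both inequalities are rearrangements of this.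

  Sum and product come from the expansion of \<open>det(I - t A)\<close> at \<open>t = 0\<close>. The zero set of the
  resultant is invariant under scaling an equation or an unknown, so the resultant is homogeneous
  for both scalings; in particular it has the same degree \<open>K\<close> in the coefficients of every
  equation. Changing the coefficient of \<open>x\<^sub>i\<^sup>m\<^sup>-\<^sup>1\<close> in the system \<open>x\<^sub>i\<^sup>m\<^sup>-\<^sup>1 = 0\<close> to \<open>1 + t\<close>
  changes the resultant to \<open>(1 + t)\<^sup>K\<close>, whereas adding \<open>t\<close> times any other monomial to one
  equation never creates a nontrivial zero, so that the resultant remains \<open>1\<close>. Hence the linear
  coefficient of \<open>det(I - t A)\<close> is \<open>-K tr A\<close>.
\<close>

section \<open>Evaluation of polynomials\<close>

lemma finite_mpoly_vars [simp]: "finite (mpoly_vars p)"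
  by (simp add: mpoly_vars_def)

lemma mpoly_eval_cong:
  assumes "\<And>v. v \<in> mpoly_vars p \<Longrightarrow> c v = c' v"
  shows "mpoly_eval c p = mpoly_eval c' p"
  unfolding mpoly_eval_def
  by (intro sum.cong prod.cong arg_cong2[where f = "(*)"] arg_cong2[where f = "(^)"] refl assms)
    (auto simp: mpoly_vars_def)

lemma poly_mpoly_eval:
  "poly (mpoly_eval c p) z = mpoly_eval (\<lambda>v. poly (c v) z) p"
  by (simp add: mpoly_eval_def poly_sum poly_prod poly_power of_int_poly)

lemma of_real_mpoly_eval:
  "of_real (mpoly_eval c p) =
    mpoly_eval (\<lambda>v. of_real (c v) :: 'a::{comm_ring_1, real_algebra_1}) p"
  by (simp add: mpoly_eval_def)

lemma of_int_mpoly_eval: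
  "of_int (mpoly_eval c p) = mpoly_eval (\<lambda>v. of_int (c v)) p"
  by (simp add: mpoly_eval_def)

text \<open>The chain rule at \<open>t = 0\<close> along the line \<open>a + t b\<close>: it reduces
  a derivative of the resultant to perturbations of one coefficient at a time.\<close>

lemma pderiv_mpoly_eval_linear:
  fixes a b :: "'v \<Rightarrow> 'a::idom"
  assumes S: "finite S" "mpoly_vars p \<subseteq> S"
  shows "poly (pderiv (mpoly_eval (\<lambda>v. [:a v, b v:]) p)) 0 =
    (\<Sum>v\<in>S.
      b v * poly (pderiv (mpoly_eval (\<lambda>u. [:a u, of_bool (u = v):]) p)) 0)"
proof -
  \<comment> \<open>\<open>L t v\<close> and \<open>D v\<close> are the partial derivatives at
    \<open>a\<close>, in the variable \<open>v\<close>, of the power product \<open>t\<close> and of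
    \<open>p\<close>.\<close>
  define L where "L t v = (if v \<in> Poly_Mapping.keys t
    then of_nat (Poly_Mapping.lookup t v) * a v ^ (Poly_Mapping.lookup t v - 1) *
      (\<Prod>u\<in>Poly_Mapping.keys t - {v}. a u ^ Poly_Mapping.lookup t u) else 0)" for t v
  define D where "D v = (\<Sum>t\<in>Poly_Mapping.keys p. of_int (Poly_Mapping.lookup p t) * L t v)" for v
  have D: "poly (pderiv (mpoly_eval (\<lambda>v. [:a v, b v:]) p)) 0 = (\<Sum>v\<in>S. b v * D v)"
    for b :: "'v \<Rightarrow> 'a"
  proof -
    have mono: "poly (pderiv (\<Prod>v\<in>Poly_Mapping.keys t. [:a v, b v:] ^ Poly_Mapping.lookup t v)) 0 =
        (\<Sum>v\<in>S. b v * L t v)" if t: "t \<in> Poly_Mapping.keys p" for t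
    proof -
      have "poly (pderiv (\<Prod>v\<in>Poly_Mapping.keys t. [:a v, b v:] ^ Poly_Mapping.lookup t v)) 0 =
          (\<Sum>v\<in>Poly_Mapping.keys t. b v * L t v)"
        unfolding pderiv_prod pderiv_power L_def
        by (auto simp: poly_sum poly_prod pderiv_pCons intro!: sum.cong)
      also have "\<dots> = (\<Sum>v\<in>S. b v * L t v)"
        using t S by (intro sum.mono_neutral_left) (auto simp: mpoly_vars_def L_def)
      finally show ?thesis .
    qed
    have "poly (pderiv (mpoly_eval (\<lambda>v. [:a v, b v:]) p)) 0 =
        (\<Sum>t\<in>Poly_Mapping.keys p. of_int (Poly_Mapping.lookup p t) *
          (\<Sum>v\<in>S. b v * L t v))"
      by (simp add: mpoly_eval_def higher_pderiv_sum[where n = 1, simplified] poly_sum pderiv_mult pderiv_smult mono of_int_poly)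
    also have "\<dots> = (\<Sum>v\<in>S. b v * D v)"
      unfolding D_def sum_distrib_left by (subst sum.swap) (simp add: mult_ac)
    finally show ?thesis .
  qed
  have "poly (pderiv (mpoly_eval (\<lambda>u. [:a u, of_bool (u = v):]) p)) 0 = D v"
    if "v \<in> S" for v
    unfolding D using that S(1) by (simp add: of_bool_def if_distrib[of "\<lambda>x. x * _"] cong: if_cong)
  then show ?thesis
    by (simp add: D)
qed

section \<open>Weighted homogeneity from an invariant zero set\<close>

lemma complex_two_power_inject:
  assumes "(2::complex) ^ a = 2 ^ b"
  shows "a = b"
  using arg_cong[OF assms, of norm] by (simp add: norm_power)

text \<open>All linear factors over the complex numbers belong to the root 0.\<close>

lemma poly_no_nonzero_roots:
  fixes p :: "complex poly"
  assumes "\<And>t. t \<noteq> 0 \<Longrightarrow> poly p t \<noteq> 0"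
  obtains a k where "p = monom a k"
proof -
  have "p \<noteq> 0"
    using assms[of 1] by auto
  have "proots p = replicate_mset (degree p) 0"
  proof -
    have "x = 0" if "x \<in># proots p" for x
      using that assms[of x] \<open>p \<noteq> 0\<close> by auto
    then show ?thesis
      using size_proots_complex[of p] by (metis set_mset_subset_singletonD singletonI subsetI)
  qed
  then have "p = smult (lead_coeff p) ([:0, 1:] ^ degree p)"
    using complex_poly_decompose_multiset[of p] by simp
  then show thesis
    using that[of "lead_coeff p" "degree p"] by (simp add: monom_altdef)
qed

text \<open>
  For a fixed point \<open>c\<close> with \<open>p(c) \<noteq> 0\<close>, the polynomial \<open>p(t\<^sup>w c)\<close> in \<open>t\<close> has no root
  except possibly \<open>0\<close>, hence is a monomial. Along the line from \<open>c\<close> to \<open>b\<close> its degree does not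
  change, so one weight serves all points.
\<close>

lemma mpoly_eval_weighted_homogeneous:
  fixes p :: "'v int_mpoly" and w :: "'v \<Rightarrow> nat" and b :: "'v \<Rightarrow> complex"
  assumes inv: "\<And>c t :: complex. t \<noteq> 0 \<Longrightarrow> mpoly_eval c p \<noteq> 0 \<Longrightarrow>
      mpoly_eval (\<lambda>v. t ^ w v * c v) p \<noteq> 0"
    and b: "mpoly_eval b p \<noteq> 0"
  obtains K where "\<And>(c :: 'v \<Rightarrow> complex) t. mpoly_eval (\<lambda>v. t ^ w v * c v) p = t ^ K * mpoly_eval c p"
proof -
  have line: "\<exists>K. \<forall>t. mpoly_eval (\<lambda>v. t ^ w v * c v) p = t ^ K * mpoly_eval c p \<and>
      mpoly_eval (\<lambda>v. t ^ w v * b v) p = t ^ K * mpoly_eval b p" for c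
  proof -
    \<comment> \<open>\<open>P\<close> is a polynomial in t with coefficients in s: the value of
      \<open>p\<close> at the weighted scaling by t of \<open>l s\<close>, the line from
      \<open>c\<close> at s = 0 to \<open>b\<close> at s = 1. \<open>V\<close> is its value at t =
      1.\<close>
    define P where "P = mpoly_eval (\<lambda>v. monom [:c v, b v - c v:] (w v)) p"
    define l where "l s = (\<lambda>v. c v + s * (b v - c v))" for s
    define V where "V = mpoly_eval (\<lambda>v. [:c v, b v - c v:]) p"
    have V: "poly V s = mpoly_eval (l s) p" for s
      by (simp add: V_def l_def poly_mpoly_eval)
    have P: "mpoly_eval (\<lambda>v. t ^ w v * l s v) p = poly (poly P [:t:]) s" for s t
      by (simp add: P_def l_def poly_mpoly_eval poly_monom poly_power algebra_simps)
    define Q where "Q s = map_poly (\<lambda>q. poly q s) P" for s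
    have coeff_Q: "coeff (Q s) k = poly (coeff P k) s" for s k
      by (simp add: Q_def coeff_map_poly)
    have Q: "poly (Q s) t = poly (poly P [:t:]) s" for s t
    proof -
      have "degree (Q s) \<le> degree P"
        by (intro degree_le) (auto simp: coeff_Q coeff_eq_0)
      then have "poly (Q s) t = (\<Sum>k\<le>degree P. coeff (Q s) k * t ^ k)"
        unfolding poly_altdef by (intro sum.mono_neutral_left) (auto simp: coeff_eq_0)
      then show ?thesis
        by (simp add: poly_altdef[of P] poly_sum coeff_Q poly_power)
    qed
    have "poly V 1 \<noteq> 0"
      using b by (simp add: V l_def)
    then have "V \<noteq> 0"
      by auto
    \<comment> \<open>Two nonzero coefficients would both survive at some s with \<open>V\<close>
      nonzero, where \<open>Q s\<close> has no root off 0 and so is a monomial.\<close>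
    have uniq: "k = j" if "coeff P k \<noteq> 0" "coeff P j \<noteq> 0" for k j
    proof -
      have "V * coeff P k * coeff P j \<noteq> 0"
        using that \<open>V \<noteq> 0\<close> by simp
      then obtain s where s: "poly (V * coeff P k * coeff P j) s \<noteq> 0"
        using poly_all_0_iff_0 by blast
      have "poly (Q s) t \<noteq> 0" if "t \<noteq> 0" for t
        using s inv[OF that, of "l s"] by (simp add: Q P[symmetric] V)
      then obtain a i where "Q s = monom a i"
        by (rule poly_no_nonzero_roots)
      then show ?thesis
        using s coeff_Q[of s k] coeff_Q[of s j] by (auto split: if_splits)
    qed
    have "poly (poly P [:1:]) 1 \<noteq> 0"
      using P[of 1 1] b by (simp add: l_def)
    then have "P \<noteq> 0"
      by auto
    then obtain K where K: "coeff P K \<noteq> 0"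
      using leading_coeff_neq_0 by blast
    then have "P = monom (coeff P K) K"
      using uniq K by - (rule poly_eqI, auto)
    then have "poly (poly P [:t:]) s = poly (coeff P K) s * t ^ K" for s t
      using poly_monom[of "coeff P K" K "[:t:]"] by (simp add: poly_power)
    then have "mpoly_eval (\<lambda>v. t ^ w v * l s v) p = t ^ K * mpoly_eval (l s) p" for s t
      using P[of t s] P[of 1 s] by simp
    \<comment> \<open>The exponent is the same for all s, in particular at both ends of the
      line.\<close>
    from this[of _ 0] this[of _ 1] show ?thesis
      by (auto simp: l_def)
  qed
  from line[of b] obtain K
    where K: "mpoly_eval (\<lambda>v. t ^ w v * b v) p = t ^ K * mpoly_eval b p" for t
    by blast
  show thesis
  proof
    fix c :: "'v \<Rightarrow> complex" and t :: complex
    from line[of c] obtain J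
      where J: "\<forall>t. mpoly_eval (\<lambda>v. t ^ w v * c v) p = t ^ J * mpoly_eval c p \<and>
        mpoly_eval (\<lambda>v. t ^ w v * b v) p = t ^ J * mpoly_eval b p"
      by blast
    have "(2::complex) ^ J = 2 ^ K"
      using K[of 2] J[rule_format, of 2] b by simp
    then have "J = K"
      by (rule complex_two_power_inject)
    with J show "mpoly_eval (\<lambda>v. t ^ w v * c v) p = t ^ K * mpoly_eval c p"
      by simp
  qed
qed

section \<open>The resultant near the power system\<close>

lemma finite_multisets_size [simp]: "finite {M :: 'n::finite multiset. size M = e}"
proof -
  have "{M :: 'n multiset. size M = e} = mset ` {js. length js = e}"
    by (auto simp: image_iff) (metis ex_mset size_mset)
  then show ?thesis
    using finite_lists_length_eq[of "UNIV :: 'n set" e] by simp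
qed

lemma finite_system_vars [simp]: "finite (system_vars (\<lambda>_. e) :: ('n::finite \<times> 'n multiset) set)"
proof -
  have "system_vars (\<lambda>_. e) = UNIV \<times> {M :: 'n multiset. size M = e}"
    by (auto simp: system_vars_def)
  then show ?thesis
    by simp
qed

lemma hom_eval_add:
  "hom_eval e (\<lambda>M. c M + c' M) x = hom_eval e c x + hom_eval e c' x"
  by (simp add: hom_eval_def distrib_right sum.distrib)

lemma hom_eval_scale: "hom_eval e (\<lambda>M. a * c M) x = a * hom_eval e c x"
  by (simp add: hom_eval_def sum_distrib_left mult.assoc)

lemma hom_eval_single:
  assumes "size N = e"
  shows "hom_eval e (\<lambda>M. of_bool (M = N)) x = (\<Prod>j\<in>#N. x $ j)"
  using assms by (simp add: hom_eval_def of_bool_def if_distrib[of "\<lambda>x. x * _"] cong: if_cong)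

lemma hom_eval_stretch:
  "hom_eval e (\<lambda>M. t ^ count M i * c M) x = hom_eval e c (\<chi> j. if j = i then t * x $ j else x $ j)"
proof -
  have "(\<Prod>j\<in>#M. if j = i then t * x $ j else x $ j) = t ^ count M i * (\<Prod>j\<in>#M. x $ j)" for M
    by (induction M) (auto simp: mult_ac)
  then show ?thesis
    by (simp add: hom_eval_def mult_ac)
qed

text \<open>The identity gives the normalising system of the resultant; a transposition gives a
  second point where the resultant is nonzero.\<close>

definition permuted_powers :: "nat \<Rightarrow> ('n \<Rightarrow> 'n) \<Rightarrow> 'n \<times> 'n multiset \<Rightarrow> complex" where
  "permuted_powers e \<pi> = (\<lambda>(i, M). of_bool (M = replicate_mset e (\<pi> i)))"

lemma hom_eval_permuted_powers:
  "hom_eval e (\<lambda>M. permuted_powers e \<pi> (i, M)) x = (x $ \<pi> i) ^ e"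
  by (simp add: permuted_powers_def hom_eval_single)

lemma of_int_power_system:
  "of_int (power_system (\<lambda>_. e) v) = permuted_powers e id v"
  by (auto simp: power_system_def permuted_powers_def split: prod.split)

section \<open>Homogeneity of the resultant in equations and in unknowns\<close>

lemma resultant_nonzeroI:
  fixes c :: "'n::finite \<times> 'n multiset \<Rightarrow> complex"
  assumes "is_resultant (\<lambda>_. e) R"
    and "\<And>x. (\<And>i. hom_eval e (\<lambda>M. c (i, M)) x = 0) \<Longrightarrow> x = 0"
  shows "mpoly_eval c R \<noteq> 0"
  using assms unfolding is_resultant_def by blast

lemma resultant_nonzeroD:
  fixes c :: "'n::finite \<times> 'n multiset \<Rightarrow> complex"
  assumes "is_resultant (\<lambda>_. e) R" "mpoly_eval c R \<noteq> 0"
    and "\<And>i. hom_eval e (\<lambda>M. c (i, M)) x = 0"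
  shows "x = 0"
  using assms unfolding is_resultant_def by blast

lemma resultant_powers:
  assumes "is_resultant (\<lambda>_. e) R"
  shows "mpoly_eval (permuted_powers e id) R = 1"
  using of_int_mpoly_eval[of "power_system (\<lambda>_. e)" R, where 'a = complex] assms
  by (simp add: of_int_power_system is_resultant_def)

text \<open>Multiplying one equation by a nonzero scalar does not change the solutions.\<close>

lemma resultant_row_homogeneous:
  fixes R :: "('n::finite \<times> 'n multiset) int_mpoly"
  assumes R: "is_resultant (\<lambda>_. e) R"
  obtains K where "\<And>(c :: 'n \<times> 'n multiset \<Rightarrow> complex) t.
    mpoly_eval (\<lambda>(j, M). (if j = i then t else 1) * c (j, M)) R = t ^ K * mpoly_eval c R"
proof -
  define w where "w = (\<lambda>(j, M :: 'n multiset). if j = i then 1 else 0 :: nat)"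
  have w: "(\<lambda>v. t ^ w v * c v) = (\<lambda>(j, M). (if j = i then t else 1) * c (j, M))"
    for c :: "'n \<times> 'n multiset \<Rightarrow> complex" and t
    by (auto simp: w_def)
  obtain K where "\<And>(c :: 'n \<times> 'n multiset \<Rightarrow> complex) t.
      mpoly_eval (\<lambda>v. t ^ w v * c v) R = t ^ K * mpoly_eval c R"
  proof (rule mpoly_eval_weighted_homogeneous[where p = R and w = w and b = "permuted_powers e id"])
    fix c :: "'n \<times> 'n multiset \<Rightarrow> complex" and t :: complex
    assume t: "t \<noteq> 0" and c: "mpoly_eval c R \<noteq> 0"
    show "mpoly_eval (\<lambda>v. t ^ w v * c v) R \<noteq> 0"
    proof (rule resultant_nonzeroI[OF R], rule resultant_nonzeroD[OF R c])
      fix x j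
      assume "\<And>j. hom_eval e (\<lambda>M. t ^ w (j, M) * c (j, M)) x = 0"
      from this[of j] show "hom_eval e (\<lambda>M. c (j, M)) x = 0"
        using t by (simp add: w_def hom_eval_scale split: if_splits)
    qed
  qed (use resultant_powers[OF R] in auto)
  then show thesis
    using that[of K] by (simp add: w)
qed

text \<open>A zero of the scaled system becomes a zero of the original one when its i-th coordinate
  is multiplied by t.\<close>

lemma resultant_column_homogeneous:
  fixes R :: "('n::finite \<times> 'n multiset) int_mpoly"
  assumes R: "is_resultant (\<lambda>_. e) R"
  obtains K where "\<And>(c :: 'n \<times> 'n multiset \<Rightarrow> complex) t.
    mpoly_eval (\<lambda>(j, M). t ^ count M i * c (j, M)) R = t ^ K * mpoly_eval c R"
proof -
  define w where "w = (\<lambda>(j :: 'n, M :: 'n multiset). count M i)"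
  have w: "(\<lambda>v. t ^ w v * c v) = (\<lambda>(j, M). t ^ count M i * c (j, M))"
    for c :: "'n \<times> 'n multiset \<Rightarrow> complex" and t
    by (auto simp: w_def)
  obtain K where "\<And>(c :: 'n \<times> 'n multiset \<Rightarrow> complex) t.
      mpoly_eval (\<lambda>v. t ^ w v * c v) R = t ^ K * mpoly_eval c R"
  proof (rule mpoly_eval_weighted_homogeneous[where p = R and w = w and b = "permuted_powers e id"])
    fix c :: "'n \<times> 'n multiset \<Rightarrow> complex" and t :: complex
    assume t: "t \<noteq> 0" and c: "mpoly_eval c R \<noteq> 0"
    show "mpoly_eval (\<lambda>v. t ^ w v * c v) R \<noteq> 0"
    proof (rule resultant_nonzeroI[OF R])
      fix x :: "complex ^ 'n"
      let ?y = "\<chi> j. if j = i then t * x $ j else x $ j"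
      assume "\<And>j. hom_eval e (\<lambda>M. t ^ w (j, M) * c (j, M)) x = 0"
      then have "?y = 0"
        by (intro resultant_nonzeroD[OF R c]) (simp add: w_def hom_eval_stretch)
      then show "x = 0"
        using t by (simp add: vec_eq_iff) (metis mult_eq_0_iff)
    qed
  qed (use resultant_powers[OF R] in auto)
  then show thesis
    using that[of K] by (simp add: w)
qed

text \<open>
  The row degrees agree: scale the unknown \<open>x\<^sub>i\<close> by \<open>t\<close> in the power system and in the same
  system with equations \<open>i\<close> and \<open>j\<close> exchanged. The resultant picks up the same power of \<open>t\<close> both
  times, but the rows scaled by \<open>t\<^sup>e\<close> are \<open>i\<close> and \<open>j\<close>, respectively.
\<close>

lemma resultant_homogeneous:
  fixes R :: "('n::finite \<times> 'n multiset) int_mpoly"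
  assumes R: "is_resultant (\<lambda>_. e) R" and e: "e > 0"
  obtains K where "\<And>(c :: 'n \<times> 'n multiset \<Rightarrow> complex) r.
    mpoly_eval (\<lambda>(i, M). r i * c (i, M)) R = (\<Prod>i\<in>UNIV. r i) ^ K * mpoly_eval c R"
proof -
  have "\<exists>K. \<forall>(c :: 'n \<times> 'n multiset \<Rightarrow> complex) t.
    mpoly_eval (\<lambda>(j, M). (if j = i then t else 1) * c (j, M)) R = t ^ K * mpoly_eval c R" for i
    by (rule resultant_row_homogeneous[OF R, of i]) blast
  then obtain D where D: "\<And>i (c :: 'n \<times> 'n multiset \<Rightarrow> complex) t.
    mpoly_eval (\<lambda>(j, M). (if j = i then t else 1) * c (j, M)) R = t ^ D i * mpoly_eval c R"
    by metis
  have D_eq: "D i = D j" for i j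
  proof -
    define \<pi> where "\<pi> = Transposition.transpose i j"
    obtain K where K: "\<And>(c :: 'n \<times> 'n multiset \<Rightarrow> complex) t.
        mpoly_eval (\<lambda>(j, M). t ^ count M i * c (j, M)) R = t ^ K * mpoly_eval c R"
      by (rule resultant_column_homogeneous[OF R, of i]) blast
    \<comment> \<open>Only equation \<open>k\<close> involves \<open>x $ i\<close>, so doubling this
      unknown multiplies row \<open>k\<close> by \<open>2 ^ e\<close>. The column degree
      \<open>K\<close> depends on \<open>i\<close> alone.\<close>
    have pow: "(2::complex) ^ (e * D k) = 2 ^ K"
      if "\<And>l. \<rho> l = i \<longleftrightarrow> l = k" "surj \<rho>" for \<rho> k
    proof -
      have "mpoly_eval (permuted_powers e \<rho>) R \<noteq> 0"
      proof (rule resultant_nonzeroI[OF R])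
        fix x :: "complex ^ 'n"
        assume "\<And>i. hom_eval e (\<lambda>M. permuted_powers e \<rho> (i, M)) x = 0"
        then have "x $ \<rho> l = 0" for l
          using e by (simp add: hom_eval_permuted_powers)
        then show "x = 0"
          unfolding vec_eq_iff zero_index using surjD[OF \<open>surj \<rho>\<close>] by metis
      qed
      moreover have "count (replicate_mset e (\<rho> l)) i = (if l = k then e else 0)" for l
        using that(1)[of l] by auto
      then have "(\<lambda>(l, M). (if l = k then 2 ^ e else 1) * permuted_powers e \<rho> (l, M)) =
          (\<lambda>(l, M). 2 ^ count M i * permuted_powers e \<rho> (l, M))"
        by (auto simp: permuted_powers_def fun_eq_iff simp del: count_replicate_mset)
      ultimately show ?thesis
        using D[of k "2 ^ e" "permuted_powers e \<rho>"] K[of 2 "permuted_powers e \<rho>"]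
        by (simp add: power_mult)
    qed
    have "(2::complex) ^ (e * D i) = 2 ^ (e * D j)"
    proof -
      have "\<pi> l = i \<longleftrightarrow> l = j" for l
        by (auto simp: \<pi>_def Transposition.transpose_def)
      moreover have "surj \<pi>"
        by (simp add: \<pi>_def)
      ultimately show ?thesis
        using pow[of id i] pow[of \<pi> j] by simp
    qed
    then have "e * D i = e * D j"
      by (rule complex_two_power_inject)
    with e show ?thesis
      by simp
  qed
  \<comment> \<open>All \<open>D i\<close> agree, so an arbitrary index names the common
    value.\<close>
  define K where "K = D undefined"
  show thesis
  proof
    fix c :: "'n \<times> 'n multiset \<Rightarrow> complex" and r
    have "mpoly_eval (\<lambda>(i, M). (if i \<in> S then r i else 1) * c (i, M)) R =
        (\<Prod>i\<in>S. r i) ^ K * mpoly_eval c R" if "finite S" for S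
      using that
    proof induction
      case empty
      show ?case by (simp add: case_prod_beta)
    next
      case (insert k S)
      have "(\<lambda>(i, M). (if i \<in> insert k S then r i else 1) * c (i, M)) =
          (\<lambda>(i, M). (if i = k then r k else 1) *
            (case (i, M) of (i, M) \<Rightarrow> (if i \<in> S then r i else 1) * c (i, M)))"
        using insert.hyps by (auto simp: fun_eq_iff)
      then show ?case
        using D[of k "r k" "\<lambda>(i, M). (if i \<in> S then r i else 1) * c (i, M)"]
          D_eq[of k undefined] insert
        by (simp add: K_def power_mult_distrib)
    qed
    from this[of UNIV] show "mpoly_eval (\<lambda>(i, M). r i * c (i, M)) R =
        (\<Prod>i\<in>UNIV. r i) ^ K * mpoly_eval c R"
      by simp
  qed
qed

text \<open>These are the partial derivatives of the resultant at the power system; only pure powers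
  rescale a row.\<close>

lemma resultant_partial_powers:
  fixes R :: "('n::finite \<times> 'n multiset) int_mpoly"
  assumes R: "is_resultant (\<lambda>_. e) R" and e: "e > 0"
    and K: "\<And>(c :: 'n \<times> 'n multiset \<Rightarrow> complex) r.
      mpoly_eval (\<lambda>(i, M). r i * c (i, M)) R = (\<Prod>i\<in>UNIV. r i) ^ K * mpoly_eval c R"
    and "size M = e"
  shows "poly (pderiv (mpoly_eval
      (\<lambda>u. [:permuted_powers e id u, of_bool (u = (i, M)):]) R)) 0 =
    (if M = replicate_mset e i then of_nat K else 0)"
proof -
  let ?I = "permuted_powers e id :: 'n \<times> 'n multiset \<Rightarrow> complex"
  define q where "q = mpoly_eval (\<lambda>u. [:?I u, of_bool (u = (i, M)):]) R"
  have q: "poly q t = mpoly_eval (\<lambda>u. ?I u + t * of_bool (u = (i, M))) R" for t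
    by (simp add: q_def poly_mpoly_eval)
  have "poly (pderiv q) 0 = (if M = replicate_mset e i then of_nat K else 0)"
  proof (cases "M = replicate_mset e i")
    case True
    have "poly q t = poly ([:1, 1:] ^ K) t" for t
    proof -
      have "(\<lambda>u. ?I u + t * of_bool (u = (i, M))) =
          (\<lambda>(j, N). (if j = i then 1 + t else 1) * ?I (j, N))"
        by (auto simp: True permuted_powers_def fun_eq_iff)
      then show ?thesis
        using K[of "\<lambda>j. if j = i then 1 + t else 1" ?I]
        by (simp add: q resultant_powers[OF R] poly_power)
    qed
    then have "q = [:1, 1:] ^ K"
      by (metis poly_eq_poly_eq_iff ext)
    then show ?thesis
      using True by (simp add: pderiv_power pderiv_pCons poly_power)
  next
    case False
    with \<open>size M = e\<close> have "\<not> set_mset M \<subseteq> {i}"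
      using set_mset_subset_singletonD[of M i] by auto
    then obtain j where j: "j \<in># M" "j \<noteq> i"
      by blast
    \<comment> \<open>The equations other than the i-th make all other unknowns 0, among them
      \<open>j\<close>. So the added monomial vanishes and the i-th equation gives
      \<open>x $ i = 0\<close>.\<close>
    have "poly q t \<noteq> 0" for t
      unfolding q
    proof (rule resultant_nonzeroI[OF R])
      fix x :: "complex ^ 'n"
      assume "\<And>k. hom_eval e (\<lambda>N. ?I (k, N) + t * of_bool ((k, N) = (i, M))) x = 0"
      then have x: "(x $ k) ^ e + t * hom_eval e (\<lambda>N. of_bool (k = i \<and> N = M)) x = 0" for k
        by (simp add: hom_eval_add hom_eval_scale hom_eval_permuted_powers)
      have other: "x $ k = 0" if "k \<noteq> i" for k
        using x[of k] that e by (simp add: hom_eval_def)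
      have "0 \<in># image_mset (($) x) M"
        using other[OF j(2)] j(1) by (metis imageI set_image_mset)
      then have "(\<Prod>k\<in>#M. x $ k) = 0"
        by (simp only: prod_mset_zero_iff)
      then have "x $ i = 0"
        using x[of i] e \<open>size M = e\<close> by (simp add: hom_eval_single del: prod_mset_zero_iff)
      with other show "x = 0"
        unfolding vec_eq_iff zero_index by metis
    qed
    then have "degree q = 0"
      using fundamental_theorem_of_algebra constant_degree by blast
    then have "pderiv q = 0"
      by (simp add: pderiv_eq_0_iff)
    then show ?thesis
      using False by simp
  qed
  then show ?thesis
    by (simp add: q_def)
qed

section \<open>Sum and product of the eigenvalues\<close>

lemma tensor_system_diff:
  fixes A B :: "('a::comm_ring_1, 'n::finite) tensor"
  shows
  "tensor_system m (\<lambda>is. A is - z * B is) v = tensor_system m A v - z * tensor_system m B v"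
  by (simp add: tensor_system_def sum_subtractf sum_distrib_left split: prod.split)

lemma tensor_system_of_real:
  "tensor_system m (\<lambda>is. of_real (A is)) v = of_real (tensor_system m A v)"
  by (simp add: tensor_system_def split: prod.split)

lemma tensor_system_replicate:
  assumes "m > 0"
  shows "tensor_system m A (i, replicate_mset (m - 1) i) = A (replicate m i)"
proof -
  have "{js. length js = m - 1 \<and> mset js = replicate_mset (m - 1) i} = {replicate (m - 1) i}"
  proof (safe)
    fix js assume "length js = m - 1" "mset js = replicate_mset (m - 1) i"
    then show "js = replicate (m - 1) i"
      by (metis in_replicate_mset replicate_length_same set_mset_mset)
  qed auto
  then show ?thesis
    using assms by (cases m) (simp_all add: tensor_system_def)
qed

text \<open>Only constant index lists contribute, so the identity tensor yields the power system,
  where the resultant is normalised.\<close>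

lemma tensor_system_id_tensor:
  fixes v :: "'n::finite \<times> 'n multiset"
  assumes "m > 0"
  shows "tensor_system m (id_tensor m) v = permuted_powers (m - 1) id v"
proof -
  obtain i M where v: "v = (i, M)"
    by (cases v)
  have entry: "id_tensor m (i # js) = of_bool (mset js = replicate_mset (m - 1) i)"
    if "length js = m - 1" for js
  proof -
    have "mset js = replicate_mset (m - 1) i \<longleftrightarrow> js = replicate (m - 1) i"
      using that by (metis in_replicate_mset mset_replicate replicate_length_same set_mset_mset)
    then show ?thesis
      using assms by (cases m) (auto simp: id_tensor_def)
  qed
  show ?thesis
  proof (cases "M = replicate_mset (m - 1) i")
    case True
    then show ?thesis
      using tensor_system_replicate[OF assms, of "id_tensor m :: (complex, 'n) tensor" i]
      by (auto simp: v permuted_powers_def id_tensor_def)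
  next
    case False
    then have "id_tensor m (i # js) = (0::complex)" if "length js = m - 1" "mset js = M" for js
      using that entry[of js] by simp
    with False show ?thesis
      by (auto simp: v tensor_system_def permuted_powers_def intro!: sum.neutral)
  qed
qed

text \<open>With constant terms 1, the lowest terms of the two sides are those of the monomials, and
  these must agree.\<close>

lemma monom_mult_eq_cancel:
  fixes p q :: "'a::idom poly"
  assumes eq: "monom a n * p = monom b k * q"
    and "coeff p 0 = 1" "coeff q 0 = 1" "a \<noteq> 0" "b \<noteq> 0"
  shows "n = k \<and> a = b \<and> p = q"
proof -
  have a: "a = (if k \<le> n then b * coeff q (n - k) else 0)"
    using arg_cong[OF eq, of "\<lambda>p. coeff p n"] assms(2) by (simp add: coeff_monom_mult)
  have b: "b = (if n \<le> k then a * coeff p (k - n) else 0)"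
    using arg_cong[OF eq, of "\<lambda>p. coeff p k"] assms(3) by (simp add: coeff_monom_mult split: if_splits)
  have "n = k"
    using a b assms(4,5) by (metis le_antisym)
  with a assms(3) have "a = b"
    by simp
  with eq \<open>n = k\<close> assms(4) show ?thesis
    by simp
qed

text \<open>
  Both \<open>t\<^sup>d \<phi>(1/t)\<close> and, by homogeneity, a power of \<open>t\<close> times \<open>det(I - t A)\<close> are constant
  multiples of the product of all \<open>1 - t \<lambda>\<^sub>i\<close>. Since the number \<open>d\<close> of eigenvalues is given,
  this determines the degree of the resultant in the coefficients of each equation.
\<close>

lemma eigenvalues_sum_prod:
  fixes A :: "(real, 'n::finite) tensor" and R :: "('n \<times> 'n multiset) int_mpoly"
  assumes m: "m \<ge> 2" and R: "is_resultant (\<lambda>_. m - 1) R"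
    and d: "d = CARD('n) * h" "h > 0"
    and ev: "eigenvalues R m A = image_mset (\<lambda>i. complex_of_real (ev i)) (mset_set {1..d})"
  shows "(\<Sum>i=1..d. ev i) = real h * tensor_trace m A"
    and "(\<Prod>i=1..d. ev i) = tensor_det R m A"
proof -
  define e where "e = m - 1"
  have e: "e > 0" and R: "is_resultant (\<lambda>_. e) R"
    using m R by (auto simp: e_def)
  obtain K where K: "\<And>(c :: 'n \<times> 'n multiset \<Rightarrow> complex) r.
    mpoly_eval (\<lambda>(i, M). r i * c (i, M)) R = (\<Prod>i\<in>UNIV. r i) ^ K * mpoly_eval c R"
    by (rule resultant_homogeneous[OF R e]) blast
  define N where "N = CARD('n) * K"
  let ?I = "permuted_powers e id :: 'n \<times> 'n multiset \<Rightarrow> complex"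
  define a where "a v = complex_of_real (tensor_system m A v)" for v
  define \<phi> where "\<phi> = tensor_charpoly R m (\<lambda>is. complex_of_real (A is))"
  \<comment> \<open>\<open>g\<close> is det(I - t A), and \<open>L\<close> is the product of all 1 -
    t \<lambda>_i.\<close>
  define g where "g = mpoly_eval (\<lambda>v. [:?I v, - a v:]) R"
  define L where "L = (\<Prod>i=1..d. [:1, - complex_of_real (ev i):])"
  define l where "l = lead_coeff \<phi>"
  have \<phi>: "poly \<phi> z = mpoly_eval (\<lambda>v. a v - z * ?I v) R" for z
    using m by (simp add: \<phi>_def poly_tensor_charpoly tensor_det_def tensor_system_diff
        tensor_system_of_real tensor_system_id_tensor a_def e_def cong: mpoly_eval_cong)
  have proots: "proots \<phi> = image_mset (\<lambda>i. complex_of_real (ev i)) (mset_set {1..d})"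
    using ev by (simp add: eigenvalues_def \<phi>_def)
  \<comment> \<open>The zero polynomial has an empty root multiset, so a positive number of roots
    excludes it.\<close>
  have "d > 0"
    using d by simp
  then have "\<phi> \<noteq> 0"
    using size_proots_complex[of \<phi>] by (auto simp: proots)
  then have "l \<noteq> 0"
    by (simp add: l_def)
  have "\<phi> = smult l (\<Prod>i=1..d. [:- complex_of_real (ev i), 1:])"
    using complex_poly_decompose_multiset[of \<phi>]
    by (simp add: proots l_def image_mset.compositionality comp_def prod_unfold_prod_mset)
  then have \<phi>_prod: "poly \<phi> z = l * (\<Prod>i=1..d. z - complex_of_real (ev i))" for z
    by (simp add: poly_prod)

  \<comment> \<open>Put z = 1/t in \<phi>: taking -1/t out of every row produces \<open>g\<close>,
    while the factorisation of \<phi> produces \<open>L\<close>.\<close>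
  have "poly (monom l N * L) t = poly (monom ((-1) ^ N) d * g) t" if t: "t \<noteq> 0" for t
  proof -
    have "(\<lambda>v. a v - 1 / t * ?I v) = (\<lambda>(i, M). (- 1 / t) * (?I (i, M) - t * a (i, M)))"
      using t by (auto simp: field_simps)
    then have "poly \<phi> (1 / t) = ((- 1 / t) ^ CARD('n)) ^ K * poly g t"
      using K[of "\<lambda>_. - 1 / t" "\<lambda>v. ?I v - t * a v"]
      by (simp add: \<phi> g_def poly_mpoly_eval)
    also have "\<dots> = (-1) ^ N / t ^ N * poly g t"
      by (simp only: N_def power_mult[symmetric] power_divide)
    finally have 1: "t ^ N * poly \<phi> (1 / t) = (-1) ^ N * poly g t"
      using t by simp
    have "t ^ d * (\<Prod>i=1..d. 1 / t - complex_of_real (ev i)) =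
        (\<Prod>i=1..d. t * (1 / t - complex_of_real (ev i)))"
      by (simp add: prod.distrib)
    also have "\<dots> = poly L t"
      using t by (simp add: L_def poly_prod right_diff_distrib)
    finally have "t ^ d * poly \<phi> (1 / t) = l * poly L t"
      unfolding \<phi>_prod by (metis mult.left_commute)
    with 1 have "t ^ N * (l * poly L t) = t ^ d * ((-1) ^ N * poly g t)"
      by (metis mult.left_commute)
    then show ?thesis
      by (simp only: poly_mult poly_monom mult_ac)
  qed
  then have "{t. poly (monom l N * L - monom ((-1) ^ N) d * g) t = 0} \<supseteq> UNIV - {0}"
    by auto
  then have "infinite {t. poly (monom l N * L - monom ((-1) ^ N) d * g) t = 0}"
    by (meson finite_Diff2 finite.emptyI finite_insert infinite_UNIV_char_0 infinite_super)
  then have eq: "monom l N * L = monom ((-1) ^ N) d * g"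
    by (metis poly_roots_finite right_minus_eq)
  have g0: "poly g 0 = 1"
    by (simp add: g_def poly_mpoly_eval resultant_powers[OF R])
  have L0: "poly L 0 = 1"
    by (simp add: L_def poly_prod)
  \<comment> \<open>Comparing lowest terms settles the degree, the leading coefficient and
    \<open>L = g\<close> at once.\<close>
  have "N = d \<and> l = (-1) ^ N \<and> L = g"
    by (rule monom_mult_eq_cancel[OF eq]) (use \<open>l \<noteq> 0\<close> g0 L0 in \<open>simp_all add: poly_0_coeff_0\<close>)
  then have "N = d" "l = (-1) ^ N" "L = g"
    by auto
  have "K = h"
    using \<open>N = d\<close> d by (simp add: N_def)

  \<comment> \<open>Along the direction \<open>- a\<close> only the pure powers contribute; their
    coefficients are the diagonal entries of \<open>A\<close>.\<close>
  have "poly (pderiv g) 0 = (\<Sum>v\<in>system_vars (\<lambda>_. e). - a v *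
      poly (pderiv (mpoly_eval (\<lambda>u. [:?I u, of_bool (u = v):]) R)) 0)"
    unfolding g_def using R
    by (intro pderiv_mpoly_eval_linear) (auto simp: is_resultant_def)
  also have "\<dots> = (\<Sum>v\<in>system_vars (\<lambda>_. e).
      if v \<in> range (\<lambda>i. (i, replicate_mset e i)) then - a v * of_nat K else 0)"
  proof (rule sum.cong)
    fix v :: "'n \<times> 'n multiset"
    assume "v \<in> system_vars (\<lambda>_. e)"
    then obtain i M where v: "v = (i, M)" "size M = e"
      by (auto simp: system_vars_def)
    moreover have "(i, M) \<in> range (\<lambda>i. (i, replicate_mset e i)) \<longleftrightarrow> M = replicate_mset e i"
      by auto
    ultimately show "- a v * poly (pderiv (mpoly_eval (\<lambda>u. [:?I u, of_bool (u = v):]) R)) 0 =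
      (if v \<in> range (\<lambda>i. (i, replicate_mset e i)) then - a v * of_nat K else 0)"
      using resultant_partial_powers[OF R e K, of M i] by simp
  qed simp
  also have "\<dots> = (\<Sum>v\<in>range (\<lambda>i. (i, replicate_mset e i)). - a v * of_nat K)"
    by (intro sum.mono_neutral_cong_right) (use finite_system_vars[of e, where 'n = 'n] in \<open>auto simp: system_vars_def\<close>)
  also have "\<dots> = - of_nat K * (\<Sum>i\<in>UNIV. a (i, replicate_mset e i))"
    by (subst sum.reindex) (simp_all add: inj_on_def sum_distrib_left mult.commute[of "of_nat K"])
  also have "(\<Sum>i\<in>UNIV. a (i, replicate_mset e i)) = complex_of_real (tensor_trace m A)"
  proof -
    have "m > 0"
      using m by simp
    then show ?thesis
      by (simp only: a_def e_def tensor_system_replicate tensor_trace_def of_real_sum)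
  qed
  finally have g': "poly (pderiv g) 0 = - of_nat K * complex_of_real (tensor_trace m A)" .
  have "poly (pderiv L) 0 = - complex_of_real (\<Sum>i=1..d. ev i)"
    by (simp add: L_def pderiv_prod poly_sum poly_prod pderiv_pCons sum_negf)
  then have "complex_of_real (\<Sum>i=1..d. ev i) = complex_of_real (real h * tensor_trace m A)"
    using g' \<open>L = g\<close> \<open>K = h\<close> by simp
  then show "(\<Sum>i=1..d. ev i) = real h * tensor_trace m A"
    by (simp only: of_real_eq_iff)

  have "complex_of_real (tensor_det R m A) = poly \<phi> 0"
    by (simp add: \<phi> a_def tensor_det_def of_real_mpoly_eval)
  \<comment> \<open>The leading coefficient \<open>(-1) ^ d\<close> supplies one sign per
    eigenvalue.\<close>
  also have "\<dots> = (\<Prod>i=1..d. (-1) * (- complex_of_real (ev i)))"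
    unfolding \<phi>_prod prod.distrib by (simp add: \<open>l = (-1) ^ N\<close> \<open>N = d\<close>)
  also have "\<dots> = complex_of_real (\<Prod>i=1..d. ev i)"
    by simp
  finally show "(\<Prod>i=1..d. ev i) = tensor_det R m A"
    by (simp only: of_real_eq_iff)
qed

section \<open>Two consequences of the AM-GM inequality\<close>

lemma prod_le_mean_power:
  fixes x :: "'a \<Rightarrow> real"
  assumes "finite S" "S \<noteq> {}" "\<And>i. i \<in> S \<Longrightarrow> x i \<ge> 0"
  shows "(\<Prod>i\<in>S. x i) \<le> ((\<Sum>i\<in>S. x i) / card S) ^ card S"
proof -
  have n: "card S > 0"
    using assms by (simp add: card_gt_0_iff)
  have P: "(\<Prod>i\<in>S. x i) \<ge> 0"
    by (simp add: assms prod_nonneg)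
  have "(\<Prod>i\<in>S. x i) = ((\<Prod>i\<in>S. x i) powr (1 / card S)) ^ card S"
    using n P by (cases "(\<Prod>i\<in>S. x i) = 0") (simp_all add: powr_powr flip: powr_realpow)
  also have "\<dots> \<le> (\<Sum>i\<in>S. x i / card S) ^ card S"
    by (rule power_mono[OF arith_geom_mean]) (use assms in auto)
  finally show ?thesis
    by (simp add: sum_divide_distrib)
qed

lemma prod_mult_le_mean_power:
  fixes x :: "'a \<Rightarrow> real"
  assumes "finite S" "\<And>i. i \<in> S \<Longrightarrow> x i \<ge> 0" "a \<ge> 0"
  shows "(\<Prod>i\<in>S. x i) * a \<le> (((\<Sum>i\<in>S. x i) + a) / (card S + 1)) ^ (card S + 1)"
proof -
  have *: "finite (insert None (Some ` S))" "card (insert None (Some ` S)) = card S + 1"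
    using assms(1) by (simp_all add: card_insert_if card_image)
  \<comment> \<open>\<open>None\<close> is a fresh index carrying the extra number
    \<open>a\<close>.\<close>
  have "(\<Prod>i\<in>insert None (Some ` S). case_option a x i) \<le>
      ((\<Sum>i\<in>insert None (Some ` S). case_option a x i) / real (card S + 1)) ^ (card S + 1)"
    using *(1) assms unfolding *(2)[symmetric] by (intro prod_le_mean_power) auto
  then show ?thesis
    using assms(1) by (simp add: prod.reindex sum.reindex mult.commute add.commute)
qed

text \<open>AM-GM for \<open>T\<close>, then for \<open>S\<close> together with the number \<open>\<Sum>i\<in>T. x i\<close>.\<close>

lemma prod_power_mult_prod_le:
  fixes x :: "'a \<Rightarrow> real"
  assumes "finite S" "finite T" "S \<inter> T = {}" "T \<noteq> {}"
    and x: "\<And>i. i \<in> S \<union> T \<Longrightarrow> x i \<ge> 0"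
  shows "(\<Prod>i\<in>S. x i) ^ card T * (\<Prod>i\<in>T. x i) \<le>
    (1 / card T * ((\<Sum>i\<in>S \<union> T. x i) / (card S + 1)) ^ (card S + 1)) ^ card T"
proof -
  have X: "(\<Prod>i\<in>S. x i) \<ge> 0" and T: "(\<Sum>i\<in>T. x i) \<ge> 0"
    using x by (auto intro: prod_nonneg sum_nonneg)
  have "(\<Prod>i\<in>S. x i) ^ card T * (\<Prod>i\<in>T. x i) \<le>
      (\<Prod>i\<in>S. x i) ^ card T * ((\<Sum>i\<in>T. x i) / card T) ^ card T"
    using assms X by (intro mult_left_mono prod_le_mean_power) auto
  also have "\<dots> = (1 / card T * ((\<Prod>i\<in>S. x i) * (\<Sum>i\<in>T. x i))) ^ card T"
    by (simp flip: power_mult_distrib)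
  also have "\<dots> \<le> (1 / card T *
      (((\<Sum>i\<in>S. x i) + (\<Sum>i\<in>T. x i)) / (card S + 1)) ^ (card S + 1)) ^ card T"
    using assms X T by (intro power_mono mult_left_mono prod_mult_le_mean_power) auto
  finally show ?thesis
    using assms by (simp add: sum.union_disjoint)
qed

section \<open>Solving the product inequality for either factor\<close>

text \<open>Divide by \<open>X * Y\<close>, which will be the determinant, and take the root of
  order \<open>q - 1\<close>.\<close>

lemma powr_upper_bound:
  fixes X Y C :: real
  assumes "X > 0" "Y > 0" "q \<ge> 2" "X ^ q * Y \<le> C"
  shows "X \<le> (1 / (X * Y) * C) powr (1 / (real q - 1))"
proof -
  have q: "real (q - 1) = real q - 1" "q - 1 > 0"
    using assms by auto
  have "X ^ q = X * X ^ (q - 1)"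
    using assms by (simp flip: power_Suc)
  then have "X ^ (q - 1) \<le> 1 / (X * Y) * C"
    using assms by (simp add: field_simps)
  then have "(X ^ (q - 1)) powr (1 / (real q - 1)) \<le> (1 / (X * Y) * C) powr (1 / (real q - 1))"
    using assms by (intro powr_mono2) auto
  moreover have "(X ^ (q - 1)) powr (1 / (real q - 1)) = X"
    using assms q by (simp add: powr_powr flip: powr_realpow)
  ultimately show ?thesis
    by simp
qed

lemma powr_lower_bound:
  fixes X Y B :: real
  assumes "X > 0" "Y > 0" "B > 0" "q \<ge> 2" "X ^ q * Y \<le> (1 / real q * B) ^ q"
  shows "(real q * (X * Y) * (1 / B)) powr (real q / (real q - 1)) \<le> Y"
proof -
  let ?Z = "real q * (X * Y) * (1 / B)"
  have q: "real (q - 1) = real q - 1" "q - 1 > 0"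
    using assms by auto
  have "?Z > 0"
    using assms by simp
  \<comment> \<open>One factor of \<open>Y ^ q\<close> is split off so that the hypothesis applies;
    its bound cancels \<open>(real q / B) ^ q\<close>.\<close>
  have "?Z ^ q = X ^ q * Y * Y ^ (q - 1) * (real q / B) ^ q"
    using assms by (simp add: power_mult_distrib power_divide flip: power_Suc)
  also have "\<dots> \<le> (1 / real q * B) ^ q * Y ^ (q - 1) * (real q / B) ^ q"
    using assms by (intro mult_right_mono) auto
  also have "\<dots> = Y ^ (q - 1) * (1 / real q * B * (real q / B)) ^ q"
    by (simp only: power_mult_distrib mult_ac)
  also have "\<dots> = Y ^ (q - 1)"
    using assms by simp
  finally have "(?Z ^ q) powr (1 / (real q - 1)) \<le> (Y ^ (q - 1)) powr (1 / (real q - 1))"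
    using assms \<open>?Z > 0\<close> by (intro powr_mono2) auto
  moreover have "(Y ^ (q - 1)) powr (1 / (real q - 1)) = Y"
    using assms q by (simp add: powr_powr flip: powr_realpow)
  moreover have "(?Z ^ q) powr (1 / (real q - 1)) = ?Z powr (real q / (real q - 1))"
    using \<open>?Z > 0\<close> by (simp only: powr_powr flip: powr_realpow) simp
  ultimately show ?thesis
    by simp
qed

theorem theorem3p4:
  fixes m d :: nat
    and A :: "(real, 'n::finite) tensor"
    and R :: "('n \<times> 'n multiset) int_mpoly"
    and ev :: "nat \<Rightarrow> real"
  assumes "m \<ge> 2" and "even m"
    and "is_resultant (\<lambda>_. m - 1) R"
    and "symmetric_tensor m A"
    and "d = CARD('n) * (m - 1) ^ (CARD('n) - 1)"
    and "eigenvalues R m A = image_mset (\<lambda>i. complex_of_real (ev i)) (mset_set {1..d})"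
    and "antimono_on {1..d} ev"
    and "\<forall>i\<in>{1..d}. ev i > 0"
  shows "(\<forall>k. 1 \<le> k \<and> k + 2 \<le> d \<longrightarrow>
            (\<Prod>i=1..k. ev i) \<le>
              (1 / tensor_det R m A *
                (1 / (real d - real k) *
                  ((real m - 1) ^ (CARD('n) - 1) * tensor_trace m A / (real k + 1)) ^ (k + 1))
                ^ (d - k))
              powr (1 / (real d - real k - 1))) \<and>
         (\<forall>k. 2 \<le> k \<and> k + 1 \<le> d \<longrightarrow>
            (\<Prod>i=d-k+1..d. ev i) \<ge>
              (real k * tensor_det R m A *
                ((real d - real k + 1) / ((real m - 1) ^ (CARD('n) - 1) * tensor_trace m A))
                ^ (d - k + 1))
              powr (real k / (real k - 1)))"
proof -
  define h where "h = (m - 1) ^ (CARD('n) - 1)"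
  define s where "s = real h * tensor_trace m A"
  have h: "h > 0" and s: "(real m - 1) ^ (CARD('n) - 1) * tensor_trace m A = s"
    using assms(1) by (simp_all add: h_def s_def of_nat_diff)
  have d: "d = CARD('n) * h"
    using assms(5) by (simp add: h_def)
  have sum_ev: "(\<Sum>i=1..d. ev i) = s" and prod_ev: "(\<Prod>i=1..d. ev i) = tensor_det R m A"
    using eigenvalues_sum_prod[OF assms(1,3) d h assms(6)] by (simp_all add: s_def)
  have pos: "ev i > 0" if "i \<in> {1..d}" for i
    using assms(8) that by blast
  have "s > 0"
    unfolding sum_ev[symmetric] using d h by (intro sum_pos pos) auto
  \<comment> \<open>\<open>X p\<close> collects the first p eigenvalues and \<open>Y p\<close> the
    other d - p; \<open>p < d\<close> below keeps the second group nonempty.\<close>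
  define X where "X p = (\<Prod>i=1..p. ev i)" for p
  define Y where "Y p = (\<Prod>i=p+1..d. ev i)" for p
  define B where "B p = (s / (real p + 1)) ^ (p + 1)" for p
  have *: "X p > 0" "Y p > 0" "B p > 0" "X p * Y p = tensor_det R m A"
    "X p ^ (d - p) * Y p \<le> (1 / real (d - p) * B p) ^ (d - p)" if p: "p < d" for p
  proof -
    have split: "{1..d} = {1..p} \<union> {p+1..d}" "{1..p} \<inter> {p+1..d} = {}"
      using p by auto
    show "X p > 0" "Y p > 0"
      unfolding X_def Y_def using p by (auto intro!: prod_pos pos)
    show "B p > 0"
      using \<open>s > 0\<close> by (simp add: B_def)
    show "X p * Y p = tensor_det R m A"
      unfolding X_def Y_def prod_ev[symmetric] split(1)
      by (intro prod.union_disjoint[symmetric]) (use split(2) in auto)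
    have "(\<Prod>i=1..p. ev i) ^ card {p+1..d} * (\<Prod>i=p+1..d. ev i) \<le>
        (1 / card {p+1..d} * ((\<Sum>i\<in>{1..p} \<union> {p+1..d}. ev i) / (card {1..p} + 1)) ^ (card {1..p} + 1))
          ^ card {p+1..d}"
      using p split by (intro prod_power_mult_prod_le less_imp_le[OF pos]) auto
    then show "X p ^ (d - p) * Y p \<le> (1 / real (d - p) * B p) ^ (d - p)"
      unfolding split(1)[symmetric] sum_ev by (simp add: X_def Y_def B_def add.commute)
  qed
  show ?thesis
    unfolding s
  proof (intro conjI allI impI)
    \<comment> \<open>Here p = k, and k \<le> d - 2 makes q = d - k at least 2.\<close>
    fix k assume k: "1 \<le> k \<and> k + 2 \<le> d"
    then have "X k \<le> (1 / (X k * Y k) * (1 / real (d - k) * B k) ^ (d - k)) powr (1 / (real (d - k) - 1))"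
      by (intro powr_upper_bound *) auto
    then show "(\<Prod>i=1..k. ev i) \<le>
        (1 / tensor_det R m A * (1 / (real d - real k) * (s / (real k + 1)) ^ (k + 1)) ^ (d - k))
          powr (1 / (real d - real k - 1))"
      using k *(4)[of k] by (simp add: X_def B_def of_nat_diff)
  next
    \<comment> \<open>Here p = d - k, so that \<open>Y p\<close> is the product of the last k
      eigenvalues and q = k.\<close>
    fix k assume k: "2 \<le> k \<and> k + 1 \<le> d"
    define p where "p = d - k"
    have p: "p < d" "k = d - p" "real p = real d - real k"
      using k by (auto simp: p_def)
    have le: "(real k * (X p * Y p) * (1 / B p)) powr (real k / (real k - 1)) \<le> Y p"
      using *[OF p(1)] k unfolding p(2)[symmetric] by (intro powr_lower_bound) auto
    have B: "1 / B p = ((real d - real k + 1) / s) ^ (d - k + 1)"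
      by (simp add: B_def p(3)[symmetric] p_def[symmetric] power_divide)
    show "(\<Prod>i=d-k+1..d. ev i) \<ge>
        (real k * tensor_det R m A * ((real d - real k + 1) / s) ^ (d - k + 1))
          powr (real k / (real k - 1))"
      using le[unfolded *(4)[OF p(1)] B, unfolded Y_def p_def] .
  qed
qed

end
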